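(* The class of $(J,\cdot,0)$-structures that are $(\dot\cup,\cap,\emptyset)$-representable by sets is axiomatised by the finite set of axioms $\mathbf{Ax}(J,\cdot,0)$ defined in the context. The class of $(J,\cdot)$-structures that are $(\dot\cup,\cap)$-representable by sets is axiomatised by the finite set of axioms $\mathbf{Ax}(J,\cdot)$ defined in the context.
   Context: For sets $S,T$, the disjoint union $S\mathbin{\dot\cup}T$ equals $S\cup T$ if $S\cap T=\emptyset$, and is undefined otherwise. Structures may be empty in signatures without $0$. A $(J,\cdot,0)$-structure has a ternary relation $J$, a total binary operation $\cdot$ and a constant $0$; a $(J,\cdot)$-structure omits $0$. A $(J,\cdot,0)$-structure $\mathfrak A$ is $(\dot\cup,\cap,\emptyset)$-representable by sets if there is a set $X$ and an injection $\theta:\mathfrak A\to\wp(X)$ whose image is closed under $\cap$, and under $\dot\cup$ wherever defined, and contains $\emptyset$, with $(a\cdot b)^\theta=a^\theta\cap b^\theta$, $0^\theta=\emptyset$, and $J(a,b,c)$ if and only if $a^\theta\mathbin{\dot\cup}b^\theta$ is defined and equal to $c^\theta$. $(\dot\cup,\cap)$-representability of a $(J,\cdot)$-structure is defined in the same way, omitting the conditions on $0$ and $\emptyset$. $\mathbf{Ax}(J,\cdot,0)$ consists of the following (free variables universally quantified): 1. $J(a,b,c)\wedge J(a,b,c')\to c=c'$; 2. $J(a,b,c)\to J(b,a,c)$; 3. $\cdot$ is commutative, associative and idempotent; 4. $J(b,c,d)\to J(a\cdot b,a\cdot c,a\cdot d)$; 5. $J(a,0,a)$; 6. $\exists c\,J(a,b,c)\leftrightarrow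 a\cdot b=0$. $\mathbf{Ax}(J,\cdot)$ consists of axioms 1–4 together with $$\exists z\big(\forall a\,J(a,z,a)\wedge\forall a,b\,(a\cdot b=z\leftrightarrow\exists c\,J(a,b,c))\big)\ \vee\ \forall a,b,c\;\neg J(a,b,c).$$ *)

theory Defs
  imports Main
begin

subsection \<open>Structures\<close>

record 'a jd =
  carrier :: "'a set"
  J :: "('a \<times> 'a \<times> 'a) set"
  dot :: "'a \<Rightarrow> 'a \<Rightarrow> 'a"

record 'a jd0 = "'a jd" +
  zero_elt :: 'a

text \<open>The carrier may be empty.\<close>

definition jd_structure :: "('a, 'r) jd_scheme \<Rightarrow> bool" where
  "jd_structure A \<longleftrightarrow>
     J A \<subseteq> carrier A \<times> carrier A \<times> carrier A \<and>
     (\<forall>a\<in>carrier A. \<forall>b\<in>carrier A. dot A a b \<in> carrier A)"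

definition jd0_structure :: "'a jd0 \<Rightarrow> bool" where
  "jd0_structure A \<longleftrightarrow> jd_structure A \<and> zero_elt A \<in> carrier A"

subsection \<open>Representations by sets\<close>

definition disjoint_union :: "'x set \<Rightarrow> 'x set \<Rightarrow> 'x set option" where
  "disjoint_union S T = (if S \<inter> T = {} then Some (S \<union> T) else None)"

definition jd_representation ::
    "('a, 'r) jd_scheme \<Rightarrow> 'x set \<Rightarrow> ('a \<Rightarrow> 'x set) \<Rightarrow> bool" where
  "jd_representation A X \<theta> \<longleftrightarrow>
     \<theta> ` carrier A \<subseteq> Pow X \<and>
     inj_on \<theta> (carrier A) \<and>
     (\<forall>S\<in>\<theta> ` carrier A. \<forall>T\<in>\<theta> ` carrier A. S \<inter> T \<in> \<theta> ` carrier A) \<and>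
     (\<forall>S\<in>\<theta> ` carrier A. \<forall>T\<in>\<theta> ` carrier A. \<forall>U.
        disjoint_union S T = Some U \<longrightarrow> U \<in> \<theta> ` carrier A) \<and>
     (\<forall>a\<in>carrier A. \<forall>b\<in>carrier A. \<theta> (dot A a b) = \<theta> a \<inter> \<theta> b) \<and>
     (\<forall>a\<in>carrier A. \<forall>b\<in>carrier A. \<forall>c\<in>carrier A.
        (a, b, c) \<in> J A \<longleftrightarrow> disjoint_union (\<theta> a) (\<theta> b) = Some (\<theta> c))"

definition jd0_representation :: "'a jd0 \<Rightarrow> 'x set \<Rightarrow> ('a \<Rightarrow> 'x set) \<Rightarrow> bool" where
  "jd0_representation A X \<theta> \<longleftrightarrow>
     jd_representation A X \<theta> \<and> {} \<in> \<theta> ` carrier A \<and> \<theta> (zero_elt A) = {}"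

text \<open>
  Representability asks for a base set \<open>X\<close> of any kind whatsoever, but a definition cannot
  quantify over the type of the elements of \<open>X\<close>.  Taking \<open>X\<close> to be a set of sets of elements of
  the structure is no restriction: by the two lemmas below, a representation over a base set of
  any type yields one of this form.
\<close>

definition jd_representable :: "('a, 'r) jd_scheme \<Rightarrow> bool" where
  "jd_representable A \<longleftrightarrow> (\<exists>(X :: 'a set set) \<theta>. jd_representation A X \<theta>)"

definition jd0_representable :: "'a jd0 \<Rightarrow> bool" where
  "jd0_representable A \<longleftrightarrow> (\<exists>(X :: 'a set set) \<theta>. jd0_representation A X \<theta>)"

lemma representation_change_base:
  fixes A :: "('a, 'r) jd_scheme" and X :: "'x set"
  assumes rep: "jd_representation A X \<theta>"
  defines "t \<equiv> \<lambda>x. {a \<in> carrier A. x \<in> \<theta> a}"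
  shows "jd_representation A (t ` X) (\<lambda>a. t ` \<theta> a)"
proof -
  have mem: "t x \<in> t ` \<theta> a \<longleftrightarrow> x \<in> \<theta> a" if "a \<in> carrier A" for x a
    using that unfolding t_def by blast
  have int: "t ` \<theta> a \<inter> t ` \<theta> b = t ` (\<theta> a \<inter> \<theta> b)"
    if "a \<in> carrier A" "b \<in> carrier A" for a b
  proof
    show "t ` \<theta> a \<inter> t ` \<theta> b \<subseteq> t ` (\<theta> a \<inter> \<theta> b)"
    proof
      fix y assume y: "y \<in> t ` \<theta> a \<inter> t ` \<theta> b"
      then obtain x where x: "x \<in> \<theta> a" "y = t x" by blast
      then have "x \<in> \<theta> b" using y mem[OF that(2), of x] by simp
      then show "y \<in> t ` (\<theta> a \<inter> \<theta> b)" using x by blast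
    qed
  qed (rule image_Int_subset)
  have eq: "t ` \<theta> a \<union> t ` \<theta> b = t ` \<theta> c \<longleftrightarrow> \<theta> a \<union> \<theta> b = \<theta> c"
    if "a \<in> carrier A" "b \<in> carrier A" "c \<in> carrier A" for a b c
  proof
    assume E: "t ` \<theta> a \<union> t ` \<theta> b = t ` \<theta> c"
    have "x \<in> \<theta> a \<union> \<theta> b \<longleftrightarrow> x \<in> \<theta> c" for x
      unfolding Un_iff mem[OF that(1), symmetric] mem[OF that(2), symmetric]
        mem[OF that(3), symmetric] E[symmetric] by (rule refl)
    then show "\<theta> a \<union> \<theta> b = \<theta> c" by blast
  next
    assume "\<theta> a \<union> \<theta> b = \<theta> c"
    then show "t ` \<theta> a \<union> t ` \<theta> b = t ` \<theta> c" by (simp add: image_Un[symmetric])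
  qed
  have du: "disjoint_union (t ` \<theta> a) (t ` \<theta> b) = Some (t ` \<theta> c) \<longleftrightarrow>
            disjoint_union (\<theta> a) (\<theta> b) = Some (\<theta> c)"
    if "a \<in> carrier A" "b \<in> carrier A" "c \<in> carrier A" for a b c
    using eq[OF that] int[OF that(1,2)] by (auto simp: disjoint_union_def)
  have inj: "inj_on (\<lambda>a. t ` \<theta> a) (carrier A)"
  proof (rule inj_onI)
    fix a b assume ab: "a \<in> carrier A" "b \<in> carrier A" "t ` \<theta> a = t ` \<theta> b"
    then have "\<theta> a = \<theta> b" using eq[of a a b] by simp
    then show "a = b" using rep ab by (auto simp: jd_representation_def dest: inj_onD)
  qed
  have clI: "t ` \<theta> a \<inter> t ` \<theta> b \<in> (\<lambda>a. t ` \<theta> a) ` carrier A"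
    if "a \<in> carrier A" "b \<in> carrier A" for a b
  proof -
    have "\<theta> a \<inter> \<theta> b \<in> \<theta> ` carrier A"
      using rep that unfolding jd_representation_def by blast
    then show ?thesis using int that by auto
  qed
  have clU: "U \<in> (\<lambda>a. t ` \<theta> a) ` carrier A"
    if ab: "a \<in> carrier A" "b \<in> carrier A"
      and U: "disjoint_union (t ` \<theta> a) (t ` \<theta> b) = Some U" for a b U
  proof -
    have disj: "\<theta> a \<inter> \<theta> b = {}" and U': "U = t ` \<theta> a \<union> t ` \<theta> b"
      using U int[OF ab] by (auto simp: disjoint_union_def split: if_splits)
    have "disjoint_union (\<theta> a) (\<theta> b) = Some (\<theta> a \<union> \<theta> b)"
      using disj by (simp add: disjoint_union_def)
    then have "\<theta> a \<union> \<theta> b \<in> \<theta> ` carrier A"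
      using rep ab unfolding jd_representation_def by blast
    then obtain c where c: "c \<in> carrier A" "\<theta> a \<union> \<theta> b = \<theta> c" by auto
    then have "U = t ` \<theta> c" using U' by (simp add: image_Un[symmetric])
    then show ?thesis using c by blast
  qed
  have sub: "(\<lambda>a. t ` \<theta> a) ` carrier A \<subseteq> Pow (t ` X)"
  proof (rule image_subsetI)
    fix a assume "a \<in> carrier A"
    then have "\<theta> a \<subseteq> X" using rep by (auto simp: jd_representation_def)
    then show "t ` \<theta> a \<in> Pow (t ` X)" by (simp add: image_mono)
  qed
  have dot: "t ` \<theta> (dot A a b) = t ` \<theta> a \<inter> t ` \<theta> b"
    if "a \<in> carrier A" "b \<in> carrier A" for a b
    using rep that int unfolding jd_representation_def by simp
  have J: "(a, b, c) \<in> J A \<longleftrightarrow> disjoint_union (t ` \<theta> a) (t ` \<theta> b) = Some (t ` \<theta> c)"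
    if "a \<in> carrier A" "b \<in> carrier A" "c \<in> carrier A" for a b c
    using rep that unfolding jd_representation_def du[OF that] by simp
  show ?thesis
    unfolding jd_representation_def ball_simps
    using sub inj clI clU dot J by (intro conjI ballI allI impI) simp_all
qed

lemma jd_representable_any_base:
  assumes "jd_representation A (X :: 'x set) \<theta>"
  shows "jd_representable A"
  using representation_change_base[OF assms] unfolding jd_representable_def by blast

lemma jd0_representable_any_base:
  assumes "jd0_representation A (X :: 'x set) \<theta>"
  shows "jd0_representable A"
proof -
  let ?t = "\<lambda>x. {a \<in> carrier A. x \<in> \<theta> a}"
  have *: "jd_representation A X \<theta>" "{} \<in> \<theta> ` carrier A" "\<theta> (zero_elt A) = {}"
    using assms by (simp_all add: jd0_representation_def)
  from *(2) obtain a where "a \<in> carrier A" "\<theta> a = {}" by auto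
  then have "{} \<in> (\<lambda>a. ?t ` \<theta> a) ` carrier A" by (intro image_eqI[of _ _ a]) simp_all
  then have "jd0_representation A (?t ` X) (\<lambda>a. ?t ` \<theta> a)"
    using representation_change_base[OF *(1)] *(3) by (simp add: jd0_representation_def)
  then show ?thesis unfolding jd0_representable_def by blast
qed

subsection \<open>First-order formulas\<close>

text \<open>
  Formulas over one ternary relation symbol and equality are parameterised by the type \<open>'t\<close> of
  terms, since the two signatures differ only in their terms.
\<close>

datatype 't fm =
    Eq 't 't
  | Rel 't 't 't
  | Not "'t fm"
  | And "'t fm" "'t fm"
  | Or "'t fm" "'t fm"
  | Imp "'t fm" "'t fm"
  | Iff "'t fm" "'t fm"
  | All nat "'t fm"
  | Ex nat "'t fm"

primrec free_vars :: "('t \<Rightarrow> nat set) \<Rightarrow> 't fm \<Rightarrow> nat set" where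
  "free_vars tv (Eq s t) = tv s \<union> tv t"
| "free_vars tv (Rel s t u) = tv s \<union> tv t \<union> tv u"
| "free_vars tv (Not p) = free_vars tv p"
| "free_vars tv (And p q) = free_vars tv p \<union> free_vars tv q"
| "free_vars tv (Or p q) = free_vars tv p \<union> free_vars tv q"
| "free_vars tv (Imp p q) = free_vars tv p \<union> free_vars tv q"
| "free_vars tv (Iff p q) = free_vars tv p \<union> free_vars tv q"
| "free_vars tv (All x p) = free_vars tv p - {x}"
| "free_vars tv (Ex x p) = free_vars tv p - {x}"

primrec sat :: "'a set \<Rightarrow> ('a \<times> 'a \<times> 'a) set \<Rightarrow> ((nat \<Rightarrow> 'a) \<Rightarrow> 't \<Rightarrow> 'a) \<Rightarrow>
    (nat \<Rightarrow> 'a) \<Rightarrow> 't fm \<Rightarrow> bool" where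
  "sat D R ev e (Eq s t) \<longleftrightarrow> ev e s = ev e t"
| "sat D R ev e (Rel s t u) \<longleftrightarrow> (ev e s, ev e t, ev e u) \<in> R"
| "sat D R ev e (Not p) \<longleftrightarrow> \<not> sat D R ev e p"
| "sat D R ev e (And p q) \<longleftrightarrow> sat D R ev e p \<and> sat D R ev e q"
| "sat D R ev e (Or p q) \<longleftrightarrow> sat D R ev e p \<or> sat D R ev e q"
| "sat D R ev e (Imp p q) \<longleftrightarrow> (sat D R ev e p \<longrightarrow> sat D R ev e q)"
| "sat D R ev e (Iff p q) \<longleftrightarrow> (sat D R ev e p \<longleftrightarrow> sat D R ev e q)"
| "sat D R ev e (All x p) \<longleftrightarrow> (\<forall>d\<in>D. sat D R ev (e(x := d)) p)"
| "sat D R ev e (Ex x p) \<longleftrightarrow> (\<exists>d\<in>D. sat D R ev (e(x := d)) p)"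

datatype jd_tm = Var nat | Dot jd_tm jd_tm

datatype jd0_tm = Var0 nat | Zero0 | Dot0 jd0_tm jd0_tm

primrec jd_tm_vars :: "jd_tm \<Rightarrow> nat set" where
  "jd_tm_vars (Var x) = {x}"
| "jd_tm_vars (Dot s t) = jd_tm_vars s \<union> jd_tm_vars t"

primrec jd0_tm_vars :: "jd0_tm \<Rightarrow> nat set" where
  "jd0_tm_vars (Var0 x) = {x}"
| "jd0_tm_vars Zero0 = {}"
| "jd0_tm_vars (Dot0 s t) = jd0_tm_vars s \<union> jd0_tm_vars t"

primrec jd_eval :: "'a jd \<Rightarrow> (nat \<Rightarrow> 'a) \<Rightarrow> jd_tm \<Rightarrow> 'a" where
  "jd_eval A e (Var x) = e x"
| "jd_eval A e (Dot s t) = dot A (jd_eval A e s) (jd_eval A e t)"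

primrec jd0_eval :: "'a jd0 \<Rightarrow> (nat \<Rightarrow> 'a) \<Rightarrow> jd0_tm \<Rightarrow> 'a" where
  "jd0_eval A e (Var0 x) = e x"
| "jd0_eval A e Zero0 = zero_elt A"
| "jd0_eval A e (Dot0 s t) = dot A (jd0_eval A e s) (jd0_eval A e t)"

text \<open>
  Truth is only used for sentences, where it does not depend on the assignment \<open>e\<close>.  Assignments
  take values in the whole type rather than in the carrier, so that one exists even when the
  carrier is empty; quantifiers range over the carrier.
\<close>

definition jd_models :: "'a jd \<Rightarrow> jd_tm fm \<Rightarrow> bool" where
  "jd_models A p \<longleftrightarrow> (\<forall>e. sat (carrier A) (J A) (jd_eval A) e p)"

definition jd0_models :: "'a jd0 \<Rightarrow> jd0_tm fm \<Rightarrow> bool" where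
  "jd0_models A p \<longleftrightarrow> (\<forall>e. sat (carrier A) (J A) (jd0_eval A) e p)"

definition jd_axiomatised_by :: "'a jd set \<Rightarrow> jd_tm fm set \<Rightarrow> bool" where
  "jd_axiomatised_by K \<Sigma> \<longleftrightarrow>
     (\<forall>p\<in>\<Sigma>. free_vars jd_tm_vars p = {}) \<and>
     K = {A. jd_structure A \<and> (\<forall>p\<in>\<Sigma>. jd_models A p)}"

definition jd0_axiomatised_by :: "'a jd0 set \<Rightarrow> jd0_tm fm set \<Rightarrow> bool" where
  "jd0_axiomatised_by K \<Sigma> \<longleftrightarrow>
     (\<forall>p\<in>\<Sigma>. free_vars jd0_tm_vars p = {}) \<and>
     K = {A. jd0_structure A \<and> (\<forall>p\<in>\<Sigma>. jd0_models A p)}"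

subsection \<open>The axioms\<close>

abbreviation Alls :: "nat list \<Rightarrow> 't fm \<Rightarrow> 't fm" where
  "Alls xs p \<equiv> foldr All xs p"

text \<open>
  The axioms common to both signatures; \<open>v\<close> and \<open>d\<close> are the variable and product constructors of
  the term language.
\<close>

definition common_axioms :: "(nat \<Rightarrow> 't) \<Rightarrow> ('t \<Rightarrow> 't \<Rightarrow> 't) \<Rightarrow> 't fm set" where
  "common_axioms v d =
    (let a = v 0; b = v 1; c = v 2; c' = v 3 in
     { Alls [0,1,2,3] (Imp (And (Rel a b c) (Rel a b c')) (Eq c c')),
       Alls [0,1,2] (Imp (Rel a b c) (Rel b a c)),
       Alls [0,1] (Eq (d a b) (d b a)),
       Alls [0,1,2] (Eq (d (d a b) c) (d a (d b c))),
       Alls [0] (Eq (d a a) a),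
       Alls [0,1,2,3] (Imp (Rel b c c') (Rel (d a b) (d a c) (d a c'))) })"

definition Ax_J_dot_0 :: "jd0_tm fm set" where
  "Ax_J_dot_0 =
    common_axioms Var0 Dot0 \<union>
    (let a = Var0 0; b = Var0 1; c = Var0 2 in
     { Alls [0] (Rel a Zero0 a),
       Alls [0,1] (Iff (Ex 2 (Rel a b c)) (Eq (Dot0 a b) Zero0)) })"

definition Ax_J_dot :: "jd_tm fm set" where
  "Ax_J_dot =
    common_axioms Var Dot \<union>
    (let a = Var 0; b = Var 1; c = Var 2; z = Var 3 in
     { Or (Ex 3 (And (Alls [0] (Rel a z a))
                     (Alls [0,1] (Iff (Eq (Dot a b) z) (Ex 2 (Rel a b c))))))
          (Alls [0,1,2] (Not (Rel a b c))) })"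

end

theory Submission
  imports Defs
begin

text \<open>
  The axioms make \<open>a \<cdot> b = a\<close> a partial order in which \<open>J(a,b,c)\<close> forces \<open>c\<close> to be the join of
  \<open>a\<close> and \<open>b\<close>, and meets distribute over the joins that \<open>J\<close> provides.  In the presence of a zero,
  an element is represented by the set of filters \<open>F\<close> containing it that omit \<open>0\<close> and are prime with
  respect to \<open>J\<close>: if \<open>J(a,b,c)\<close> and \<open>c \<in> F\<close>, then \<open>a \<in> F\<close> or \<open>b \<in> F\<close>.  By Zorn's lemma, if
  \<open>a \<le> b\<close> fails, there is a filter maximal among those that contain \<open>a\<close> but not \<open>b\<close>, and
  distributivity makes it prime; so prime filters separate elements.  If \<open>J\<close> is empty, the
  representation by principal ideals with one common point added to all of them has no two
  disjoint sets.  Conversely, a nonempty \<open>J\<close> yields two disjoint sets, so their intersection, the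
  empty set, represents an element, which is the required \<open>z\<close>.
\<close>

section \<open>Meet semilattices with a partial join relation, and their filters\<close>

locale partial_join_semilattice =
  fixes D :: "'a set" and R :: "('a \<times> 'a \<times> 'a) set" and m :: "'a \<Rightarrow> 'a \<Rightarrow> 'a"
  assumes R_carrier: "(a, b, c) \<in> R \<Longrightarrow> a \<in> D \<and> b \<in> D \<and> c \<in> D"
    and m_closed [simp]: "a \<in> D \<Longrightarrow> b \<in> D \<Longrightarrow> m a b \<in> D"
    and R_unique: "(a, b, c) \<in> R \<Longrightarrow> (a, b, c') \<in> R \<Longrightarrow> c = c'"
    and R_sym: "(a, b, c) \<in> R \<Longrightarrow> (b, a, c) \<in> R"
    and m_commute: "a \<in> D \<Longrightarrow> b \<in> D \<Longrightarrow> m a b = m b a"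
    and m_assoc: "a \<in> D \<Longrightarrow> b \<in> D \<Longrightarrow> c \<in> D \<Longrightarrow> m (m a b) c = m a (m b c)"
    and m_idem [simp]: "a \<in> D \<Longrightarrow> m a a = a"
    and R_distrib: "a \<in> D \<Longrightarrow> (b, c, d) \<in> R \<Longrightarrow> (m a b, m a c, m a d) \<in> R"
begin

lemma m_left_commute: "a \<in> D \<Longrightarrow> b \<in> D \<Longrightarrow> c \<in> D \<Longrightarrow> m a (m b c) = m b (m a c)"
  by (metis m_assoc m_commute)

lemma m_left_idem: "a \<in> D \<Longrightarrow> b \<in> D \<Longrightarrow> m a (m a b) = m a b"
  by (metis m_assoc m_idem)

text \<open>With \<open>m_idem\<close>, these rules sort the factors of a product and cancel
  repetitions.\<close>

lemmas m_ac = m_assoc m_commute m_left_commute m_left_idem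

text \<open>\<open>m a b = a\<close> expresses \<open>a \<le> b\<close>. Both the empty set and
  \<open>D\<close> itself count as filters.\<close>

definition is_filter :: "'a set \<Rightarrow> bool" where
  "is_filter F \<longleftrightarrow> F \<subseteq> D \<and> (\<forall>a\<in>F. \<forall>b\<in>F. m a b \<in> F) \<and> (\<forall>a\<in>F. \<forall>b\<in>D. m a b = a \<longrightarrow> b \<in> F)"

lemma is_filter_m_iff:
  assumes "is_filter F" "a \<in> D" "b \<in> D"
  shows "m a b \<in> F \<longleftrightarrow> a \<in> F \<and> b \<in> F"
proof
  assume ab: "m a b \<in> F"
  have "m (m a b) a = m a b" "m (m a b) b = m a b"
    using assms by (simp_all add: m_ac)
  then show "a \<in> F \<and> b \<in> F" using assms ab unfolding is_filter_def by blast
qed (use assms in \<open>auto simp: is_filter_def\<close>)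

text \<open>For nonempty \<open>F\<close> this is the filter generated by \<open>F\<close> and
  \<open>x\<close>. If \<open>m f x\<close> lies below \<open>a\<close> and \<open>m g x\<close>
  below \<open>b\<close>, then \<open>m (m f g) x\<close> lies below \<open>m a b\<close>.\<close>

lemma is_filter_generate:
  assumes F: "is_filter F" and x: "x \<in> D"
  shows "is_filter {y \<in> D. \<exists>f\<in>F. m (m f x) y = m f x}" (is "is_filter ?G")
  unfolding is_filter_def
proof (intro conjI ballI impI)
  fix a b assume "a \<in> ?G" "b \<in> ?G"
  then obtain f g where *: "a \<in> D" "b \<in> D" "f \<in> F" "g \<in> F"
      "m (m f x) a = m f x" "m (m g x) b = m g x" by blast
  have D: "f \<in> D" "g \<in> D" using F * by (auto simp: is_filter_def)
  have "m (m (m f g) x) (m a b) = m (m (m f x) a) (m (m g x) b)"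
    using D *(1,2) x by (simp add: m_ac)
  also have "\<dots> = m (m f g) x" unfolding *(5,6) using D x by (simp add: m_ac)
  finally show "m a b \<in> ?G" using F * unfolding is_filter_def by auto
next
  fix a b assume "a \<in> ?G" and b: "b \<in> D" and ab: "m a b = a"
  then obtain f where *: "a \<in> D" "f \<in> F" "m (m f x) a = m f x" by blast
  have D: "f \<in> D" using F * by (auto simp: is_filter_def)
  have "m (m f x) b = m (m f x) (m a b)" using D * x b by (metis m_assoc m_closed)
  then have "m (m f x) b = m f x" using ab * by simp
  then show "b \<in> ?G" using b * by blast
qed auto

text \<open>To keep base points in the type \<open>'a set\<close>, the common point is coded by
  \<open>{}\<close> and an element \<open>x\<close> by \<open>{x}\<close>. No disjoint union of
  images is ever defined, in agreement with \<open>R = {}\<close>.\<close>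

lemma representation_if_no_joins:
  assumes "R = {}"
  defines "\<theta> \<equiv> \<lambda>a. insert {} ((\<lambda>x. {x}) ` {x \<in> D. m x a = x})"
  shows "jd_representation \<lparr>carrier = D, J = R, dot = m, \<dots> = r\<rparr> UNIV \<theta>"
proof -
  have "inj_on \<theta> D"
  proof (rule inj_onI)
    fix a b assume ab: "a \<in> D" "b \<in> D" "\<theta> a = \<theta> b"
    \<comment> \<open>So \<open>a\<close> and \<open>b\<close> have the same lower bounds; taking
      \<open>x\<close> to be \<open>a\<close> and then \<open>b\<close> gives both
      inequalities.\<close>
    have "m x a = x \<longleftrightarrow> m x b = x" if "x \<in> D" for x
      using that arg_cong[OF ab(3), of "\<lambda>S. {x} \<in> S"] by (auto simp: \<theta>_def)
    then show "a = b" using ab by (metis m_commute m_idem)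
  qed
  moreover have int: "\<theta> (m a b) = \<theta> a \<inter> \<theta> b" if ab: "a \<in> D" "b \<in> D" for a b
  proof -
    have "m x (m a b) = x \<longleftrightarrow> m x a = x \<and> m x b = x" if x: "x \<in> D" for x
      using ab x by (metis m_assoc m_closed m_idem m_commute)
    then show ?thesis by (auto simp: \<theta>_def)
  qed
  moreover have "disjoint_union (\<theta> a) (\<theta> b) = None" for a b
    by (auto simp: disjoint_union_def \<theta>_def)
  ultimately show ?thesis
    using assms(1) by (auto simp: jd_representation_def simp flip: int)
qed

end

section \<open>Zero, joins and prime filters\<close>

locale partial_join_semilattice_zero = partial_join_semilattice +
  fixes z
  assumes z_carrier [simp]: "z \<in> D"
    and R_zero: "a \<in> D \<Longrightarrow> (a, z, a) \<in> R"
    and R_defined_iff: "a \<in> D \<Longrightarrow> b \<in> D \<Longrightarrow> (\<exists>c. (a, b, c) \<in> R) \<longleftrightarrow> m a b = z"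
begin

lemma m_zero: "a \<in> D \<Longrightarrow> m a z = z" "a \<in> D \<Longrightarrow> m z a = z"
  using R_zero R_defined_iff m_commute by (metis z_carrier)+

text \<open>As \<open>m a b = z\<close>, multiplying by \<open>a\<close> gives
  \<open>(a, z, m a c) \<in> R\<close>; comparison with \<open>(a, z, a) \<in> R\<close> yields
  \<open>m a c = a\<close>.\<close>

lemma R_upper:
  assumes "(a, b, c) \<in> R"
  shows "m a c = a" "m b c = b"
proof -
  have *: "m a c = a" if abc: "(a, b, c) \<in> R" for a b
  proof -
    have D: "a \<in> D" "b \<in> D" using R_carrier abc by blast+
    have "m a b = z" using R_defined_iff D abc by blast
    then have "(a, z, m a c) \<in> R" using R_distrib[OF D(1) abc] D by simp
    then show ?thesis using R_zero[OF D(1)] R_unique by blast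
  qed
  show "m a c = a" "m b c = b" using * assms R_sym by blast+
qed

text \<open>Multiplying by \<open>d\<close> fixes \<open>a\<close> and \<open>b\<close>, so
  \<open>m d c\<close> is also a join of this pair and equals \<open>c\<close> by
  \<open>R_unique\<close>.\<close>

lemma R_least:
  assumes R: "(a, b, c) \<in> R" and d: "d \<in> D" and "m a d = a" "m b d = b"
  shows "m c d = c"
proof -
  have D: "a \<in> D" "b \<in> D" "c \<in> D" using R_carrier R by blast+
  have "(a, b, m d c) \<in> R" using R_distrib[OF d R] D assms by (simp add: m_commute)
  then show ?thesis using R R_unique D d by (metis m_commute)
qed

definition prime_filter :: "'a set \<Rightarrow> bool" where
  "prime_filter F \<longleftrightarrow> is_filter F \<and> z \<notin> F \<and> (\<forall>(a, b, c)\<in>R. c \<in> F \<longrightarrow> a \<in> F \<or> b \<in> F)"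

text \<open>If \<open>x\<close> and \<open>y\<close> are outside \<open>F\<close> but their join
  \<open>c\<close> is inside, then by maximality adjoining either one to \<open>F\<close> captures
  \<open>b\<close>. A common multiplier from \<open>F\<close> then brings a multiple of
  \<open>c\<close> below \<open>b\<close>, which forces \<open>b \<in> F\<close>.\<close>

lemma prime_filter_if_maximal:
  assumes F: "is_filter F" and b: "b \<in> D" "b \<notin> F"
    and max: "\<And>G. is_filter G \<Longrightarrow> F \<subseteq> G \<Longrightarrow> b \<notin> G \<Longrightarrow> G = F"
  shows "prime_filter F"
  unfolding prime_filter_def
proof (intro conjI F ballI, safe)
  assume "z \<in> F"
  then show False using F b m_zero unfolding is_filter_def by blast
next
  fix x y c assume R: "(x, y, c) \<in> R" and c: "c \<in> F" and y: "y \<notin> F"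
  have D: "x \<in> D" "y \<in> D" "c \<in> D" using R_carrier R by blast+
  have below_b: "\<exists>f\<in>F. m (m f u) b = m f u" if u: "u \<in> D" "u \<notin> F" for u
  proof -
    let ?G = "{y \<in> D. \<exists>f\<in>F. m (m f u) y = m f u}"
    have sub: "F \<subseteq> ?G"
    proof
      fix y assume y: "y \<in> F"
      then have "y \<in> D" using F by (auto simp: is_filter_def)
      moreover then have "m (m y u) y = m y u" using u by (simp add: m_ac)
      ultimately show "y \<in> ?G" using y by blast
    qed
    \<comment> \<open>The member \<open>c\<close> of \<open>F\<close> witnesses
      \<open>u \<in> ?G\<close>. Hence \<open>?G\<close> differs from \<open>F\<close>, and
      maximality puts \<open>b\<close> into it.\<close>
    have cu: "m (m c u) u = m c u" using u D by (simp add: m_ac)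
    then have "u \<in> ?G" using u c by blast
    then have "b \<in> ?G" using max[OF is_filter_generate[OF F u(1)] sub] u by blast
    then show ?thesis by blast
  qed
  show "x \<in> F"
  proof (rule ccontr)
    assume "x \<notin> F"
    then obtain f where f: "f \<in> F" "m (m f x) b = m f x" using below_b D by blast
    obtain g where g: "g \<in> F" "m (m g y) b = m g y" using below_b D y by blast
    have fgD: "f \<in> D" "g \<in> D" using F f g by (auto simp: is_filter_def)
    \<comment> \<open>\<open>h\<close> lies below \<open>f\<close> and \<open>g\<close>, so
      \<open>m h x\<close> and \<open>m h y\<close> both lie below \<open>b\<close>.\<close>
    define h where "h = m (m f g) c"
    have h: "h \<in> F" using F f g c by (auto simp: is_filter_def h_def)
    have hD: "h \<in> D" using h F by (auto simp: is_filter_def)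
    have hx: "m (m h x) b = m h x"
    proof -
      have "m (m h x) b = m (m g c) (m (m f x) b)"
        using fgD D b by (simp add: h_def m_ac)
      also have "\<dots> = m h x" unfolding f(2) using fgD D by (simp add: h_def m_ac)
      finally show ?thesis .
    qed
    have hy: "m (m h y) b = m h y"
    proof -
      have "m (m h y) b = m (m f c) (m (m g y) b)"
        using fgD D b by (simp add: h_def m_ac)
      also have "\<dots> = m h y" unfolding g(2) using fgD D by (simp add: h_def m_ac)
      finally show ?thesis .
    qed
    \<comment> \<open>By \<open>R_distrib\<close>, \<open>m h c\<close> is the join of
      \<open>m h x\<close> and \<open>m h y\<close>, so their upper bound \<open>b\<close> bounds it
      too.\<close>
    have "m (m h c) b = m h c" using R_least[OF R_distrib[OF hD R] b(1) hx hy] .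
    moreover have "m h c \<in> F" using F h c by (auto simp: is_filter_def)
    ultimately show False using F b unfolding is_filter_def by blast
  qed
qed

lemma prime_filter_separation:
  assumes a: "a \<in> D" and b: "b \<in> D" and ab: "m a b \<noteq> a"
  obtains F where "prime_filter F" "a \<in> F" "b \<notin> F"
proof -
  let ?S = "{F. is_filter F \<and> a \<in> F \<and> b \<notin> F}"
  have "is_filter {y \<in> D. m a y = a}"
  proof -
    have "m a (m x y) = a" if "x \<in> D" "y \<in> D" "m a x = a" "m a y = a" for x y
      using that a by (metis m_assoc)
    moreover have "m a y = a" if "x \<in> D" "y \<in> D" "m a x = a" "m x y = x" for x y
      using that a by (metis m_assoc)
    ultimately show ?thesis by (auto simp: is_filter_def)
  qed
  \<comment> \<open>The principal filter of \<open>a\<close> omits \<open>b\<close> because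
    \<open>a\<close> is not below \<open>b\<close>; it makes the family for Zorn's lemma
    nonempty.\<close>
  then have "{y \<in> D. m a y = a} \<in> ?S" using a ab by simp
  then have ne: "?S \<noteq> {}" by blast
  have "\<Union>C \<in> ?S" if ne: "C \<noteq> {}" and C: "subset.chain ?S C" for C
  proof -
    have sub: "\<And>F. F \<in> C \<Longrightarrow> is_filter F \<and> a \<in> F \<and> b \<notin> F"
      and lin: "\<And>F G. F \<in> C \<Longrightarrow> G \<in> C \<Longrightarrow> F \<subseteq> G \<or> G \<subseteq> F"
      using C by (auto simp: subset_chain_def)
    have "m x y \<in> \<Union>C" if "x \<in> \<Union>C" "y \<in> \<Union>C" for x y
    proof -
      obtain F where "F \<in> C" "x \<in> F" "y \<in> F" using \<open>x \<in> \<Union>C\<close> \<open>y \<in> \<Union>C\<close> lin by blast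
      then show ?thesis using sub unfolding is_filter_def by blast
    qed
    moreover have "y \<in> \<Union>C" if "x \<in> \<Union>C" "y \<in> D" "m x y = x" for x y
      using that sub unfolding is_filter_def by blast
    moreover have "\<Union>C \<subseteq> D" using sub unfolding is_filter_def by blast
    ultimately have "is_filter (\<Union>C)" unfolding is_filter_def by blast
    then show ?thesis using sub ne by blast
  qed
  then obtain F where F: "F \<in> ?S" and max: "\<forall>G\<in>?S. F \<subseteq> G \<longrightarrow> G = F"
    using subset_Zorn_nonempty[OF ne] by blast
  have "prime_filter F"
    \<comment> \<open>Every \<open>G\<close> above \<open>F\<close> contains \<open>a\<close>, so
      maximality in \<open>?S\<close> covers all filter extensions of \<open>F\<close> that omit
      \<open>b\<close>.\<close>
    using F max b by (intro prime_filter_if_maximal[of F b]) auto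
  then show ?thesis using that F by blast
qed

text \<open>Separation yields injectivity; for joins, \<open>R_upper\<close> and primality give the
  two inclusions between \<open>\<theta> a \<union> \<theta> b\<close> and
  \<open>\<theta> c\<close>. The free record extension \<open>r\<close> lets the result serve both
  signatures.\<close>

lemma representation_by_prime_filters:
  defines "\<theta> \<equiv> \<lambda>a. {F. prime_filter F \<and> a \<in> F}"
  shows "jd_representation \<lparr>carrier = D, J = R, dot = m, \<dots> = r\<rparr> UNIV \<theta>" "\<theta> z = {}"
proof -
  show zero: "\<theta> z = {}" by (auto simp: \<theta>_def prime_filter_def)
  have mono: "m a b = a" if ab: "a \<in> D" "b \<in> D" "\<theta> a \<subseteq> \<theta> b" for a b
  proof (rule ccontr)
    assume "m a b \<noteq> a"
    then obtain F where "prime_filter F" "a \<in> F" "b \<notin> F"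
      using prime_filter_separation ab by metis
    then show False using ab by (auto simp: \<theta>_def)
  qed
  have inj: "a = b" if "a \<in> D" "b \<in> D" "\<theta> a = \<theta> b" for a b
    using that mono m_commute by (metis order_refl)
  have int: "\<theta> (m a b) = \<theta> a \<inter> \<theta> b" if "a \<in> D" "b \<in> D" for a b
    using that by (auto simp: \<theta>_def prime_filter_def is_filter_m_iff)
  have disj: "\<theta> a \<inter> \<theta> b = {} \<longleftrightarrow> m a b = z" if "a \<in> D" "b \<in> D" for a b
    using that inj[of "m a b" z] zero by (auto simp flip: int)
  have un: "\<theta> a \<union> \<theta> b = \<theta> c" if R: "(a, b, c) \<in> R" for a b c
  proof
    show "\<theta> a \<union> \<theta> b \<subseteq> \<theta> c"
      using R R_upper[OF R] R_carrier[OF R] int[of a c] int[of b c] by auto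
    show "\<theta> c \<subseteq> \<theta> a \<union> \<theta> b"
      using R by (auto simp: \<theta>_def prime_filter_def)
  qed
  have closed: "\<exists>c\<in>D. (a, b, c) \<in> R" if "a \<in> D" "b \<in> D" "\<theta> a \<inter> \<theta> b = {}" for a b
    using that(3) disj[OF that(1,2)] R_defined_iff[OF that(1,2)] R_carrier[of a b] by blast
  have J: "(a, b, c) \<in> R \<longleftrightarrow> disjoint_union (\<theta> a) (\<theta> b) = Some (\<theta> c)"
    if D: "a \<in> D" "b \<in> D" "c \<in> D" for a b c
  proof
    assume R: "(a, b, c) \<in> R"
    then have "\<theta> a \<inter> \<theta> b = {}" using disj R_defined_iff D by blast
    then show "disjoint_union (\<theta> a) (\<theta> b) = Some (\<theta> c)"
      using un[OF R] by (simp add: disjoint_union_def)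
  next
    assume "disjoint_union (\<theta> a) (\<theta> b) = Some (\<theta> c)"
    then have *: "\<theta> a \<inter> \<theta> b = {}" "\<theta> a \<union> \<theta> b = \<theta> c"
      by (auto simp: disjoint_union_def split: if_splits)
    \<comment> \<open>Disjointness alone supplies some join \<open>d\<close>; its image is
      \<open>\<theta> c\<close>, so injectivity identifies \<open>d\<close> with
      \<open>c\<close>.\<close>
    then obtain d where "d \<in> D" "(a, b, d) \<in> R" using closed D by blast
    then show "(a, b, c) \<in> R" using un * inj D by metis
  qed
  have clU: "U \<in> \<theta> ` D"
    if D: "a \<in> D" "b \<in> D" and U: "disjoint_union (\<theta> a) (\<theta> b) = Some U" for a b U
  proof -
    have *: "\<theta> a \<inter> \<theta> b = {}" "\<theta> a \<union> \<theta> b = U"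
      using U by (auto simp: disjoint_union_def split: if_splits)
    then obtain d where "d \<in> D" "(a, b, d) \<in> R" using closed D by blast
    then show ?thesis using un * by blast
  qed
  show "jd_representation \<lparr>carrier = D, J = R, dot = m, \<dots> = r\<rparr> UNIV \<theta>"
    unfolding jd_representation_def ball_simps jd.simps
    using J clU inj int by (intro conjI ballI allI impI inj_onI) (simp_all flip: int)
qed

end

section \<open>Soundness of the axioms in set representations\<close>

lemma jd_representationD:
  assumes "jd_representation A X \<theta>" "a \<in> carrier A" "b \<in> carrier A"
  shows "\<theta> a = \<theta> b \<Longrightarrow> a = b"
    and "\<theta> (dot A a b) = \<theta> a \<inter> \<theta> b"
    and "\<theta> a \<inter> \<theta> b = {} \<Longrightarrow> \<exists>c\<in>carrier A. \<theta> a \<union> \<theta> b = \<theta> c"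
    and "c \<in> carrier A \<Longrightarrow>
      (a, b, c) \<in> J A \<longleftrightarrow> \<theta> a \<inter> \<theta> b = {} \<and> \<theta> a \<union> \<theta> b = \<theta> c"
proof -
  show "\<theta> a = \<theta> b \<Longrightarrow> a = b"
    using assms by (auto simp: jd_representation_def dest: inj_onD)
  show "\<theta> (dot A a b) = \<theta> a \<inter> \<theta> b"
    using assms by (simp add: jd_representation_def)
  show "(a, b, c) \<in> J A \<longleftrightarrow> \<theta> a \<inter> \<theta> b = {} \<and> \<theta> a \<union> \<theta> b = \<theta> c" if "c \<in> carrier A"
    using assms that by (simp add: jd_representation_def disjoint_union_def)
  show "\<exists>c\<in>carrier A. \<theta> a \<union> \<theta> b = \<theta> c" if "\<theta> a \<inter> \<theta> b = {}"
  proof -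
    have "disjoint_union (\<theta> a) (\<theta> b) = Some (\<theta> a \<union> \<theta> b)"
      using that by (simp add: disjoint_union_def)
    moreover have "\<forall>S\<in>\<theta> ` carrier A. \<forall>T\<in>\<theta> ` carrier A. \<forall>U.
        disjoint_union S T = Some U \<longrightarrow> U \<in> \<theta> ` carrier A"
      using assms(1) unfolding jd_representation_def by (elim conjE)
    ultimately show ?thesis using assms(2,3) by blast
  qed
qed

text \<open>Each law holds for intersections and disjoint unions of sets; equations return to
  elements by injectivity.\<close>

lemma partial_join_semilattice_if_representation:
  assumes str: "jd_structure A" and rep: "jd_representation A X \<theta>"
  shows "partial_join_semilattice (carrier A) (J A) (dot A)"
proof
  let ?D = "carrier A"
  note inj = jd_representationD(1)[OF rep] and dot = jd_representationD(2)[OF rep]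
  show R: "(a, b, c) \<in> J A \<Longrightarrow> a \<in> ?D \<and> b \<in> ?D \<and> c \<in> ?D" for a b c
    using str unfolding jd_structure_def by blast
  show closed: "a \<in> ?D \<Longrightarrow> b \<in> ?D \<Longrightarrow> dot A a b \<in> ?D" for a b
    using str unfolding jd_structure_def by blast
  have J: "(a, b, c) \<in> J A \<longleftrightarrow>
      a \<in> ?D \<and> b \<in> ?D \<and> c \<in> ?D \<and> \<theta> a \<inter> \<theta> b = {} \<and> \<theta> a \<union> \<theta> b = \<theta> c" for a b c
    using jd_representationD(4)[OF rep] R by blast
  show "(a, b, c) \<in> J A \<Longrightarrow> (a, b, c') \<in> J A \<Longrightarrow> c = c'" for a b c c'
    using inj by (auto simp: J)
  show "(a, b, c) \<in> J A \<Longrightarrow> (b, a, c) \<in> J A" for a b c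
    by (auto simp: J)
  show "a \<in> ?D \<Longrightarrow> b \<in> ?D \<Longrightarrow> dot A a b = dot A b a" for a b
    using closed dot by (intro inj) auto
  show "a \<in> ?D \<Longrightarrow> b \<in> ?D \<Longrightarrow> c \<in> ?D \<Longrightarrow> dot A (dot A a b) c = dot A a (dot A b c)" for a b c
    using closed dot by (intro inj) auto
  show "a \<in> ?D \<Longrightarrow> dot A a a = a" for a
    using closed dot by (intro inj) auto
  show "(dot A a b, dot A a c, dot A a d) \<in> J A" if "a \<in> ?D" "(b, c, d) \<in> J A" for a b c d
    using that closed dot unfolding J by auto
qed

text \<open>The empty set is neutral for disjoint union. By injectivity \<open>dot A a b = z\<close>
  holds just when the images are disjoint, and then closure of the image under disjoint union
  produces the join.\<close>

lemma partial_join_semilattice_zero_if_representation: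
  assumes str: "jd_structure A" and rep: "jd_representation A X \<theta>"
    and z: "z \<in> carrier A" "\<theta> z = {}"
  shows "partial_join_semilattice_zero (carrier A) (J A) (dot A) z"
proof -
  interpret partial_join_semilattice "carrier A" "J A" "dot A"
    using partial_join_semilattice_if_representation[OF str rep] .
  show ?thesis
  proof
    show "z \<in> carrier A" by fact
    show "(a, z, a) \<in> J A" if "a \<in> carrier A" for a
      using jd_representationD(4)[OF rep that z(1) that] z(2) by simp
    show "(\<exists>c. (a, b, c) \<in> J A) \<longleftrightarrow> dot A a b = z" if D: "a \<in> carrier A" "b \<in> carrier A" for a b
    proof -
      have "dot A a b = z \<longleftrightarrow> \<theta> a \<inter> \<theta> b = {}"
        using jd_representationD(1)[OF rep _ z(1), of "dot A a b"]
          jd_representationD(2)[OF rep D] z(2) D by auto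
      then show ?thesis
        using jd_representationD(3)[OF rep D] jd_representationD(4)[OF rep D] R_carrier by metis
    qed
  qed
qed

section \<open>Representability characterised by the two locales\<close>

lemma jd0_representable_iff:
  assumes "jd0_structure A"
  shows "jd0_representable A \<longleftrightarrow>
    partial_join_semilattice_zero (carrier A) (J A) (dot A) (zero_elt A)"
proof
  assume "jd0_representable A"
  then obtain X :: "'a set set" and \<theta>
    where rep: "jd_representation A X \<theta>" "\<theta> (zero_elt A) = {}"
    unfolding jd0_representable_def jd0_representation_def by blast
  show "partial_join_semilattice_zero (carrier A) (J A) (dot A) (zero_elt A)"
    using partial_join_semilattice_zero_if_representation[OF _ rep(1) _ rep(2)] assms
    by (simp add: jd0_structure_def)
next
  assume "partial_join_semilattice_zero (carrier A) (J A) (dot A) (zero_elt A)"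
  then interpret partial_join_semilattice_zero "carrier A" "J A" "dot A" "zero_elt A" .
  \<comment> \<open>The extension part of \<open>A\<close>, which holds \<open>zero_elt\<close>,
    instantiates the free \<open>r\<close> of the representation lemma.\<close>
  have A: "\<lparr>carrier = carrier A, J = J A, dot = dot A, \<dots> = jd.more A\<rparr> = A"
    by (rule jd.surjective[symmetric])
  have "jd0_representation A UNIV (\<lambda>a. {F. prime_filter F \<and> a \<in> F})"
    unfolding jd0_representation_def
  proof (intro conjI)
    show "jd_representation A UNIV (\<lambda>a. {F. prime_filter F \<and> a \<in> F})"
      using representation_by_prime_filters(1)[of "jd.more A"] unfolding A .
    show zero: "{F. prime_filter F \<and> zero_elt A \<in> F} = {}"
      by (rule representation_by_prime_filters)
    show "{} \<in> (\<lambda>a. {F. prime_filter F \<and> a \<in> F}) ` carrier A"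
      using zero z_carrier by (intro image_eqI[of _ _ "zero_elt A"]) auto
  qed
  then show "jd0_representable A" unfolding jd0_representable_def by blast
qed

lemma jd_representable_iff:
  fixes A :: "('a, 'r) jd_scheme"
  assumes "jd_structure A"
  shows "jd_representable A \<longleftrightarrow>
    (\<exists>z. partial_join_semilattice_zero (carrier A) (J A) (dot A) z) \<or>
    partial_join_semilattice (carrier A) (J A) (dot A) \<and> J A = {}" (is "_ \<longleftrightarrow> ?R")
proof
  assume "jd_representable A"
  then obtain X :: "'a set set" and \<theta> where rep: "jd_representation A X \<theta>"
    unfolding jd_representable_def by blast
  interpret partial_join_semilattice "carrier A" "J A" "dot A"
    using partial_join_semilattice_if_representation[OF assms rep] .
  show ?R
  proof (cases "J A = {}")
    case True
    then show ?thesis using partial_join_semilattice_axioms by blast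
  next
    case False
    then obtain a b c where abc: "(a, b, c) \<in> J A" by auto
    then have D: "a \<in> carrier A" "b \<in> carrier A" "c \<in> carrier A" using R_carrier by blast+
    \<comment> \<open>Elements joined by \<open>J\<close> have disjoint images, so
      \<open>dot A a b\<close> serves as the zero.\<close>
    then have "\<theta> (dot A a b) = {}"
      using jd_representationD(2,4)[OF rep D(1,2)] abc by simp
    then show ?thesis
      using partial_join_semilattice_zero_if_representation[OF assms rep] D m_closed by blast
  qed
next
  have A: "\<lparr>carrier = carrier A, J = J A, dot = dot A, \<dots> = jd.more A\<rparr> = A"
    by (rule jd.surjective[symmetric])
  assume ?R
  then show "jd_representable A"
  proof (elim disjE exE conjE)
    fix z assume "partial_join_semilattice_zero (carrier A) (J A) (dot A) z"
    then interpret partial_join_semilattice_zero "carrier A" "J A" "dot A" z .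
    show ?thesis
      using representation_by_prime_filters(1)[of "jd.more A"]
      unfolding A jd_representable_def by blast
  next
    assume "partial_join_semilattice (carrier A) (J A) (dot A)" "J A = {}"
    then interpret partial_join_semilattice "carrier A" "J A" "dot A" by blast
    show ?thesis
      using representation_if_no_joins[OF \<open>J A = {}\<close>, of "jd.more A"]
      unfolding A jd_representable_def by blast
  qed
qed

section \<open>Translation of the first-order axioms into the locales\<close>

text \<open>Abstracting over \<open>ev\<close>, \<open>v\<close> and \<open>d\<close> treats both
  term languages at once. Formula quantifiers are bounded by \<open>D\<close>; the inclusion of
  \<open>R\<close> in \<open>D \<times> D \<times> D\<close> frees the laws about \<open>R\<close>
  from these bounds.\<close>

lemma sat_common_axioms_iff:
  assumes "\<And>e n. ev e (v n) = e n" "\<And>e s t. ev e (d s t) = m (ev e s) (ev e t)"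
    and "R \<subseteq> D \<times> D \<times> D" "\<forall>a\<in>D. \<forall>b\<in>D. m a b \<in> D"
  shows "(\<forall>p\<in>common_axioms v d. \<forall>e. sat D R ev e p) \<longleftrightarrow> partial_join_semilattice D R m"
proof -
  have "(\<forall>p\<in>common_axioms v d. \<forall>e. sat D R ev e p) \<longleftrightarrow>
    (\<forall>a\<in>D. \<forall>b\<in>D. \<forall>c\<in>D. \<forall>c'\<in>D. (a, b, c) \<in> R \<and> (a, b, c') \<in> R \<longrightarrow> c = c') \<and>
    (\<forall>a\<in>D. \<forall>b\<in>D. \<forall>c\<in>D. (a, b, c) \<in> R \<longrightarrow> (b, a, c) \<in> R) \<and>
    (\<forall>a\<in>D. \<forall>b\<in>D. m a b = m b a) \<and>
    (\<forall>a\<in>D. \<forall>b\<in>D. \<forall>c\<in>D. m (m a b) c = m a (m b c)) \<and>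
    (\<forall>a\<in>D. m a a = a) \<and>
    (\<forall>a\<in>D. \<forall>b\<in>D. \<forall>c\<in>D. \<forall>d\<in>D. (b, c, d) \<in> R \<longrightarrow> (m a b, m a c, m a d) \<in> R)"
    (is "_ \<longleftrightarrow> ?A1 \<and> ?A2 \<and> ?A3 \<and> ?A4 \<and> ?A5 \<and> ?A6")
    by (simp add: common_axioms_def Let_def assms(1,2))
  also have "\<dots> \<longleftrightarrow> partial_join_semilattice D R m"
  proof (rule iffI, elim conjE)
    have R: "\<And>a b c. (a, b, c) \<in> R \<Longrightarrow> a \<in> D \<and> b \<in> D \<and> c \<in> D" using assms(3) by blast
    assume A: ?A1 ?A2 ?A3 ?A4 ?A5 ?A6
    show "partial_join_semilattice D R m"
    proof
      show "\<And>a b c. (a, b, c) \<in> R \<Longrightarrow> a \<in> D \<and> b \<in> D \<and> c \<in> D" by (fact R)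
      show "\<And>a b. a \<in> D \<Longrightarrow> b \<in> D \<Longrightarrow> m a b \<in> D" using assms(4) by blast
      show "\<And>a b c c'. (a, b, c) \<in> R \<Longrightarrow> (a, b, c') \<in> R \<Longrightarrow> c = c'" using A(1) R by meson
      show "\<And>a b c. (a, b, c) \<in> R \<Longrightarrow> (b, a, c) \<in> R" using A(2) R by meson
      show "\<And>a b. a \<in> D \<Longrightarrow> b \<in> D \<Longrightarrow> m a b = m b a" using A(3) by blast
      show "\<And>a b c. a \<in> D \<Longrightarrow> b \<in> D \<Longrightarrow> c \<in> D \<Longrightarrow> m (m a b) c = m a (m b c)"
        using A(4) by blast
      show "\<And>a. a \<in> D \<Longrightarrow> m a a = a" using A(5) by blast
      show "\<And>a b c d. a \<in> D \<Longrightarrow> (b, c, d) \<in> R \<Longrightarrow> (m a b, m a c, m a d) \<in> R"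
        using A(6) R by meson
    qed
  next
    assume "partial_join_semilattice D R m"
    then interpret partial_join_semilattice D R m .
    show "?A1 \<and> ?A2 \<and> ?A3 \<and> ?A4 \<and> ?A5 \<and> ?A6"
      by (intro conjI ballI impI) (auto intro: R_unique R_sym m_commute m_assoc R_distrib)
  qed
  finally show ?thesis .
qed

lemma partial_join_semilattice_zero_iff:
  assumes "R \<subseteq> D \<times> D \<times> D"
  shows "partial_join_semilattice_zero D R m z \<longleftrightarrow>
    partial_join_semilattice D R m \<and> z \<in> D \<and> (\<forall>a\<in>D. (a, z, a) \<in> R) \<and>
    (\<forall>a\<in>D. \<forall>b\<in>D. m a b = z \<longleftrightarrow> (\<exists>c\<in>D. (a, b, c) \<in> R))"
proof -
  have "(\<exists>c\<in>D. (a, b, c) \<in> R) \<longleftrightarrow> (\<exists>c. (a, b, c) \<in> R)" for a b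
    using assms by blast
  then show ?thesis
    unfolding partial_join_semilattice_zero_def partial_join_semilattice_zero_axioms_def
    \<comment> \<open>\<open>eq_commute\<close> on truth values aligns the orientations of the
      biconditional; \<open>HOL.Ex\<close> is the logical quantifier, not the formula constructor
      \<open>Ex\<close>.\<close>
    by (simp add: Ball_def eq_commute[of "_ = z" "HOL.Ex _"])
qed

lemma models_Ax_J_dot_0_iff:
  assumes "jd0_structure A"
  shows "(\<forall>p\<in>Ax_J_dot_0. jd0_models A p) \<longleftrightarrow>
    partial_join_semilattice_zero (carrier A) (J A) (dot A) (zero_elt A)"
proof -
  have str: "J A \<subseteq> carrier A \<times> carrier A \<times> carrier A"
      "\<forall>a\<in>carrier A. \<forall>b\<in>carrier A. dot A a b \<in> carrier A" "zero_elt A \<in> carrier A"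
    using assms by (auto simp: jd0_structure_def jd_structure_def)
  have common: "(\<forall>p\<in>common_axioms Var0 Dot0. jd0_models A p) \<longleftrightarrow>
      partial_join_semilattice (carrier A) (J A) (dot A)"
    unfolding jd0_models_def by (rule sat_common_axioms_iff) (use str in auto)
  have "(\<forall>p\<in>Ax_J_dot_0. jd0_models A p) \<longleftrightarrow>
    partial_join_semilattice (carrier A) (J A) (dot A) \<and>
    (\<forall>a\<in>carrier A. (a, zero_elt A, a) \<in> J A) \<and>
    (\<forall>a\<in>carrier A. \<forall>b\<in>carrier A. (\<exists>c\<in>carrier A. (a, b, c) \<in> J A) \<longleftrightarrow> dot A a b = zero_elt A)"
    unfolding Ax_J_dot_0_def ball_Un common by (simp add: Let_def jd0_models_def)
  then show ?thesis
    unfolding partial_join_semilattice_zero_iff[OF str(1)]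
    by (simp add: str(3) eq_commute[of "_ = zero_elt A" "Bex _ _"])
qed

text \<open>Distributing the common axioms over the disjunctive one yields the two cases; the zero
  is the witness of its existential quantifier.\<close>

lemma models_Ax_J_dot_iff:
  assumes "jd_structure A"
  shows "(\<forall>p\<in>Ax_J_dot. jd_models A p) \<longleftrightarrow>
    (\<exists>z. partial_join_semilattice_zero (carrier A) (J A) (dot A) z) \<or>
    partial_join_semilattice (carrier A) (J A) (dot A) \<and> J A = {}"
proof -
  have str: "J A \<subseteq> carrier A \<times> carrier A \<times> carrier A"
      "\<forall>a\<in>carrier A. \<forall>b\<in>carrier A. dot A a b \<in> carrier A"
    using assms by (auto simp: jd_structure_def)
  have common: "(\<forall>p\<in>common_axioms Var Dot. jd_models A p) \<longleftrightarrow>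
      partial_join_semilattice (carrier A) (J A) (dot A)"
    unfolding jd_models_def by (rule sat_common_axioms_iff) (use str in auto)
  \<comment> \<open>The second disjunct of the axiom; an empty carrier falls under it.\<close>
  have emp: "J A = {} \<longleftrightarrow> (\<forall>a\<in>carrier A. \<forall>b\<in>carrier A. \<forall>c\<in>carrier A. (a, b, c) \<notin> J A)"
    using str by blast
  have "(\<forall>p\<in>Ax_J_dot. jd_models A p) \<longleftrightarrow>
    partial_join_semilattice (carrier A) (J A) (dot A) \<and>
    ((\<exists>z\<in>carrier A. (\<forall>a\<in>carrier A. (a, z, a) \<in> J A) \<and>
      (\<forall>a\<in>carrier A. \<forall>b\<in>carrier A. dot A a b = z \<longleftrightarrow> (\<exists>c\<in>carrier A. (a, b, c) \<in> J A))) \<or>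
     J A = {})"
    unfolding Ax_J_dot_def ball_Un common emp by (simp add: Let_def jd_models_def)
  then show ?thesis
    unfolding partial_join_semilattice_zero_iff[OF str(1)] by blast
qed

lemma finite_common_axioms: "finite (common_axioms v d)"
  by (simp add: common_axioms_def Let_def)

lemma free_vars_common_axioms:
  assumes "\<And>n. tv (v n) = {n}" "\<And>s t. tv (d s t) = tv s \<union> tv t"
  shows "\<forall>p\<in>common_axioms v d. free_vars tv p = {}"
  by (auto simp: common_axioms_def Let_def assms)

theorem theorem6p1:
  shows "finite Ax_J_dot_0 \<and>
         jd0_axiomatised_by {A :: 'a jd0. jd0_structure A \<and> jd0_representable A} Ax_J_dot_0 \<and>
         finite Ax_J_dot \<and>
         jd_axiomatised_by {A :: 'a jd. jd_structure A \<and> jd_representable A} Ax_J_dot"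
proof (intro conjI)
  show "finite Ax_J_dot_0" "finite Ax_J_dot"
    by (simp_all add: Ax_J_dot_0_def Ax_J_dot_def Let_def finite_common_axioms)
  have "\<forall>p\<in>Ax_J_dot_0. free_vars jd0_tm_vars p = {}"
    unfolding Ax_J_dot_0_def ball_Un
    by (intro conjI free_vars_common_axioms) (auto simp: Let_def)
  then show "jd0_axiomatised_by {A :: 'a jd0. jd0_structure A \<and> jd0_representable A} Ax_J_dot_0"
    unfolding jd0_axiomatised_by_def
    \<comment> \<open>Representability and truth of the axioms reduce to the same locale
      predicate.\<close>
    using jd0_representable_iff models_Ax_J_dot_0_iff by blast
  have "\<forall>p\<in>Ax_J_dot. free_vars jd_tm_vars p = {}"
    unfolding Ax_J_dot_def ball_Un
    by (intro conjI free_vars_common_axioms) (auto simp: Let_def)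
  then show "jd_axiomatised_by {A :: 'a jd. jd_structure A \<and> jd_representable A} Ax_J_dot"
    unfolding jd_axiomatised_by_def
    using jd_representable_iff models_Ax_J_dot_iff by blast
qed

end
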